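(* Let $p>1$, $\gamma>0$ and $a=p-1$. Let $\lambda$ be Lebesgue measure on $[0,1]$, and define probability measures on $[0,1]$ by $\nu=(1+a)x^a\lambda$ and $\pi=a x^{a-1}\lambda$. Let $(Y_i)_{i\in\mathbb{N}}$ be the stationary Markov chain on $[0,1]$ with law $\pi$ and transition probabilities $$K(x,A)=(1-x)\delta_x(A)+x\,\nu(A).$$ There exists $\kappa>0$ such that, for any integer $n\ge1$ and any $x\in[\kappa n^{1/p},\kappa^{-1}n]$, $$\mathbb{P}\Big(\max_{1\le k\le n}\Big|\sum_{i=0}^{k-1}\big(Y_i^\gamma-\mathbb{E}(Y_i^\gamma)\big)\Big|\ge x\Big)\ge\kappa^{-1}\frac{n}{x^p}.$$
   Context: Here $\delta_x$ is the Dirac measure at $x$. The measure $\pi$ is the unique invariant probability measure, considered by the paper, of the chain with transition probabilities $K(x,\cdot)$; stationarity means that $Y_0$ has law $\pi$. *)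

theory Defs
  imports "HOL-Probability.Probability"
begin

definition natural_filtration ::
  "'w measure \<Rightarrow> 'b measure \<Rightarrow> (nat \<Rightarrow> 'w \<Rightarrow> 'b) \<Rightarrow> nat \<Rightarrow> 'w measure" where
  "natural_filtration M S Y n =
     sigma (space M) (\<Union>i\<le>n. {Y i -` A \<inter> space M | A. A \<in> sets S})"

lemma subalgebra_natural_filtration:
  assumes "\<And>i. Y i \<in> M \<rightarrow>\<^sub>M S"
  shows "subalgebra M (natural_filtration M S Y n)"
proof -
  have *: "(\<Union>i\<le>n. {Y i -` A \<inter> space M | A. A \<in> sets S}) \<subseteq> sets M"
    using assms by (auto intro: measurable_sets)
  then have "(\<Union>i\<le>n. {Y i -` A \<inter> space M | A. A \<in> sets S}) \<subseteq> Pow (space M)"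
    using sets.space_closed by (rule subset_trans)
  then show ?thesis
    using sets.sigma_sets_subset[OF *]
    by (simp add: subalgebra_def natural_filtration_def)
qed

text \<open>
  A Markov chain on the probability space \<open>M\<close> with state space \<open>S\<close>, initial law \<open>\<mu>\<close> and
  transition probabilities \<open>K\<close>: for every measurable \<open>A\<close>, almost surely
  \<open>P(Y (n+1) \<in> A | Y 0, \<dots>, Y n) = K (Y n) A\<close>. If \<open>\<mu>\<close> is invariant under \<open>K\<close>, the chain is
  stationary.
\<close>

definition markov_chain ::
  "'w measure \<Rightarrow> 'b measure \<Rightarrow> 'b measure \<Rightarrow> ('b \<Rightarrow> 'b set \<Rightarrow> real) \<Rightarrow> (nat \<Rightarrow> 'w \<Rightarrow> 'b) \<Rightarrow> bool"
  where
  "markov_chain M S \<mu> K Y \<longleftrightarrow>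
     prob_space M \<and>
     (\<forall>i. Y i \<in> M \<rightarrow>\<^sub>M S) \<and>
     distr M S (Y 0) = \<mu> \<and>
     (\<forall>n. \<forall>A\<in>sets S. AE \<omega> in M.
        real_cond_exp M (natural_filtration M S Y n) (\<lambda>\<omega>. indicator A (Y (Suc n) \<omega>)) \<omega>
          = K (Y n \<omega>) A)"

abbreviation unit_borel :: "real measure" where
  "unit_borel \<equiv> restrict_space borel {0..1}"

definition unit_lebesgue :: "real measure" where
  "unit_lebesgue = restrict_space lborel {0..1}"

definition nu_law :: "real \<Rightarrow> real measure" where
  "nu_law a = density unit_lebesgue (\<lambda>x. ennreal ((1 + a) * x powr a))"

definition pi_law :: "real \<Rightarrow> real measure" where
  "pi_law a = density unit_lebesgue (\<lambda>x. ennreal (a * x powr (a - 1)))"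

definition trans_prob :: "real \<Rightarrow> real \<Rightarrow> real set \<Rightarrow> real" where
  "trans_prob a x A = (1 - x) * measure (return unit_borel x) A + x * measure (nu_law a) A"

end

theory Submission imports Defs begin

text \<open>
  Large deviations of the partial sums are caused by one long visit near \<open>0\<close>. The chain leaves a
  point \<open>y\<close> with probability at most \<open>y\<close>, so once it has jumped below \<open>d = \<epsilon> / t\<close> it stays below
  \<open>d\<close> for \<open>t\<close> further steps with probability bounded away from \<open>0\<close>. During such a visit each centred
  term \<open>Y\<^sub>i\<^sup>\<gamma> - E(Y\<^sub>i\<^sup>\<gamma>)\<close> is at most \<open>- \<mu> / 2\<close>, where \<open>\<mu> > 0\<close> is a lower bound for all the
  means. The partial sums at the two ends of the visit therefore differ by at least \<open>t \<mu> / 2\<close>, and one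
  of them has absolute value at least \<open>t \<mu> / 4\<close>. Taking \<open>t\<close> of order \<open>x\<close> makes this at least \<open>x\<close>
  (\<open>max_partial_sum_ge_on_excursion\<close>).

  It remains to see that a visit of length \<open>t\<close> occurs before time \<open>n\<close> with probability of order
  \<open>n / t\<^sup>p\<close>. A visit starts at a given time by a jump from above \<open>1 / 2\<close> to below \<open>d\<close>; this has
  probability of order \<open>\<nu> [0, d] = d\<^sup>p\<close>, uniformly in time, because the chain is stationary and \<open>\<pi>\<close>
  charges \<open>(1 / 2, 1]\<close> (\<open>prob_excursion_ge\<close>). There are about \<open>n\<close> possible starting times. Two visits
  whose time windows overlap exclude each other, and if one visit is already over, the Markov
  property bounds the conditional probability that another starts now by \<open>d\<^sup>p\<close>
  (\<open>prob_early_excursion_and_restart_le\<close>). As \<open>x \<ge> n\<^bsup>1/p\<^esup>\<close> gives \<open>n d\<^sup>p \<le> 1\<close>, this loss is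
  at most half and the probability of the union is comparable with the sum of the probabilities
  (\<open>prob_UN_excursion_ge\<close>).
\<close>

section \<open>The laws \<open>\<nu>\<close> and \<open>\<pi>\<close>\<close>

lemma sets_unit_lebesgue: "sets unit_lebesgue = sets unit_borel"
  by (simp add: unit_lebesgue_def sets_restrict_space)

lemma sets_nu_law [simp]: "sets (nu_law a) = sets unit_borel"
  by (simp add: nu_law_def sets_unit_lebesgue)

lemma sets_pi_law [simp]: "sets (pi_law a) = sets unit_borel"
  by (simp add: pi_law_def sets_unit_lebesgue)

lemma measurable_unit_lebesgue [measurable (raw)]:
  "f \<in> borel_measurable borel \<Longrightarrow> f \<in> borel_measurable unit_lebesgue"
  unfolding unit_lebesgue_def by (intro measurable_restrict_space1) simp

lemma measurable_unit_borel [measurable (raw)]: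
  "f \<in> borel_measurable borel \<Longrightarrow> f \<in> borel_measurable unit_borel"
  by (intro measurable_restrict_space1)

lemma Icc_unit_borel: "d \<le> 1 \<Longrightarrow> {0..d} \<in> sets unit_borel" for d :: real
  by (subst sets_restrict_space_iff) auto

lemma Ioc_unit_borel: "0 \<le> b \<Longrightarrow> {b<..1} \<in> sets unit_borel" for b :: real
  by (subst sets_restrict_space_iff) auto

lemma emeasure_nu_law_Icc:
  assumes "a > 0" "0 \<le> d" "d \<le> 1"
  shows "emeasure (nu_law a) {0..d} = ennreal (d powr (1 + a))"
proof -
  have "((\<lambda>x. x powr a) has_integral (d powr (a + 1) / (a + 1))) {0..d}"
    using assms by (intro has_integral_powr_from_0) auto
  from has_integral_mult_right[OF this, of "1 + a"]
  have I: "((\<lambda>x. (1 + a) * x powr a) has_integral d powr (1 + a)) {0..d}"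
    using assms by (simp add: add.commute)
  have "emeasure (nu_law a) {0..d}
      = (\<integral>\<^sup>+x. ennreal ((1 + a) * x powr a) * indicator {0..d} x \<partial>unit_lebesgue)"
    unfolding nu_law_def using Icc_unit_borel[OF assms(3)]
    by (subst emeasure_density) (auto simp: sets_unit_lebesgue)
  also have "\<dots> = (\<integral>\<^sup>+x. ennreal ((1 + a) * x powr a) * indicator {0..d} x
      * indicator {0..1} x \<partial>lborel)"
    unfolding unit_lebesgue_def by (subst nn_integral_restrict_space) auto
  also have "\<dots> = (\<integral>\<^sup>+x. ennreal ((1 + a) * x powr a) * indicator {0..d} x \<partial>lborel)"
    using assms by (intro nn_integral_cong) (auto simp: indicator_def)
  also have "\<dots> = ennreal (d powr (1 + a))"
    using assms by (intro nn_integral_has_integral_lebesgue'[OF _ I]) auto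
  finally show ?thesis .
qed

lemma measure_nu_law_Icc:
  "a > 0 \<Longrightarrow> 0 \<le> d \<Longrightarrow> d \<le> 1 \<Longrightarrow> measure (nu_law a) {0..d} = d powr (1 + a)"
  by (simp add: measure_def emeasure_nu_law_Icc)

lemma space_nu_law [simp]: "space (nu_law a) = {0..1}"
  by (simp add: nu_law_def unit_lebesgue_def space_restrict_space)

lemma space_pi_law [simp]: "space (pi_law a) = {0..1}"
  by (simp add: pi_law_def unit_lebesgue_def space_restrict_space)

lemma prob_space_nu_law: "a > 0 \<Longrightarrow> prob_space (nu_law a)"
  by (intro prob_spaceI) (simp add: emeasure_nu_law_Icc)

text \<open>
  Size-biasing \<open>\<pi>\<close> gives \<open>\<nu>\<close> up to the factor \<open>a / (1 + a)\<close>, the mean of \<open>\<pi>\<close>. This balances the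
  mass of \<open>\<pi>\<close> that leaves a set with the mass that jumps into it, hence the invariance of \<open>\<pi>\<close>. It
  also gives \<open>\<pi> \<ge> a / (1 + a) \<nu>\<close>, by which bounds on \<open>\<pi>\<close> reduce to the distribution function of \<open>\<nu>\<close>.
\<close>

lemma nn_integral_pi_law_size_bias:
  assumes "a > 0" "A \<in> sets unit_borel"
  shows "(\<integral>\<^sup>+x. ennreal x * indicator A x \<partial>pi_law a)
    = ennreal (a / (1 + a)) * emeasure (nu_law a) A"
proof -
  have [measurable]: "A \<in> sets unit_lebesgue"
    using assms by (simp add: sets_unit_lebesgue)
  have "(\<integral>\<^sup>+x. ennreal x * indicator A x \<partial>pi_law a)
      = (\<integral>\<^sup>+x. ennreal (a * x powr (a - 1)) * (ennreal x * indicator A x) \<partial>unit_lebesgue)"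
    unfolding pi_law_def by (subst nn_integral_density) auto
  also have "\<dots> = (\<integral>\<^sup>+x. ennreal (a / (1 + a))
      * (ennreal ((1 + a) * x powr a) * indicator A x) \<partial>unit_lebesgue)"
  proof (intro nn_integral_cong)
    fix x assume "x \<in> space unit_lebesgue"
    then have x: "0 \<le> x" by (auto simp: unit_lebesgue_def space_restrict_space)
    have "a * x powr (a - 1) * x = a / (1 + a) * ((1 + a) * x powr a)"
      using x assms(1) by (cases "x = 0") (auto simp: powr_diff)
    then have "ennreal (a * x powr (a - 1)) * ennreal x
        = ennreal (a / (1 + a)) * ennreal ((1 + a) * x powr a)"
      using x assms(1) by (simp flip: ennreal_mult)
    then show "ennreal (a * x powr (a - 1)) * (ennreal x * indicator A x)
        = ennreal (a / (1 + a)) * (ennreal ((1 + a) * x powr a) * indicator A x)"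
      by (simp flip: mult.assoc)
  qed
  also have "\<dots> = ennreal (a / (1 + a))
      * (\<integral>\<^sup>+x. ennreal ((1 + a) * x powr a) * indicator A x \<partial>unit_lebesgue)"
    by (intro nn_integral_cmult) measurable
  also have "(\<integral>\<^sup>+x. ennreal ((1 + a) * x powr a) * indicator A x \<partial>unit_lebesgue)
      = emeasure (nu_law a) A"
    unfolding nu_law_def by (subst emeasure_density) auto
  finally show ?thesis .
qed

lemma integral_pi_law_size_bias:
  assumes "a > 0" "A \<in> sets unit_borel"
  shows "(LINT x|pi_law a. x * indicator A x) = a / (1 + a) * measure (nu_law a) A"
proof -
  interpret nu: prob_space "nu_law a" using assms(1) by (rule prob_space_nu_law)
  have [measurable]: "A \<in> sets (pi_law a)" using assms(2) by simp
  have [measurable]: "(\<lambda>x. x) \<in> borel_measurable (pi_law a)"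
    unfolding pi_law_def by simp
  have "(LINT x|pi_law a. x * indicator A x)
      = enn2real (\<integral>\<^sup>+x. ennreal (x * indicator A x) \<partial>pi_law a)"
    by (intro integral_eq_nn_integral) (auto simp: indicator_def)
  also have "(\<integral>\<^sup>+x. ennreal (x * indicator A x) \<partial>pi_law a)
      = (\<integral>\<^sup>+x. ennreal x * indicator A x \<partial>pi_law a)"
    by (intro nn_integral_cong) (auto simp: indicator_def)
  also have "\<dots> = ennreal (a / (1 + a) * measure (nu_law a) A)"
    using assms by (simp add: nn_integral_pi_law_size_bias nu.emeasure_eq_measure flip: ennreal_mult)
  finally show ?thesis using assms(1) by simp
qed

lemma trans_prob_eq:
  assumes "A \<in> sets unit_borel"
  shows "trans_prob a x A = (1 - x) * indicator A x + x * measure (nu_law a) A"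
  using assms by (simp add: trans_prob_def measure_return)

section \<open>One step of the chain\<close>

locale lazy_chain =
  fixes a :: real and M :: "'w measure" and Y :: "nat \<Rightarrow> 'w \<Rightarrow> real"
  assumes a_pos: "a > 0"
    and chain: "markov_chain M unit_borel (pi_law a) (trans_prob a) Y"
begin

sublocale prob_space M
  using chain by (simp add: markov_chain_def)

sublocale nu: prob_space "nu_law a"
  using a_pos by (rule prob_space_nu_law)

abbreviation F :: "nat \<Rightarrow> 'w measure" where
  "F n \<equiv> natural_filtration M unit_borel Y n"

lemma Y_measurable_unit: "Y i \<in> M \<rightarrow>\<^sub>M unit_borel"
  using chain by (simp add: markov_chain_def)

lemma Y_measurable [measurable]: "Y i \<in> borel_measurable M"
  using Y_measurable_unit measurable_restrict_space2_iff by blast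

lemma Y_range: "\<omega> \<in> space M \<Longrightarrow> 0 \<le> Y i \<omega> \<and> Y i \<omega> \<le> 1"
  using Y_measurable_unit[of i] measurable_restrict_space2_iff[of "Y i" M borel "{0..1}"] by auto

lemma space_F: "space (F n) = space M"
  by (simp add: natural_filtration_def space_measure_of_conv)

lemma sets_F_subset: "sets (F n) \<subseteq> sets M"
  using subalgebra_natural_filtration[OF Y_measurable_unit] by (simp add: subalgebra_def)

lemma Y_measurable_F:
  assumes "i \<le> n"
  shows "Y i \<in> borel_measurable (F n)"
proof -
  have "Y i \<in> F n \<rightarrow>\<^sub>M unit_borel"
  proof (rule measurableI)
    show "Y i \<omega> \<in> space unit_borel" if "\<omega> \<in> space (F n)" for \<omega>
      using that Y_range[of \<omega> i] by (simp add: space_F space_restrict_space)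
    fix A assume "A \<in> sets unit_borel"
    then have "Y i -` A \<inter> space M \<in> (\<Union>i\<le>n. {Y i -` A \<inter> space M | A. A \<in> sets unit_borel})"
      using assms by auto
    then show "Y i -` A \<inter> space (F n) \<in> sets (F n)"
      unfolding space_F unfolding natural_filtration_def
      by (subst sets_measure_of) auto
  qed
  then show ?thesis using measurable_restrict_space2_iff by blast
qed

lemma indicator_Y_measurable:
  "A \<in> sets unit_borel \<Longrightarrow> (\<lambda>\<omega>. indicator A (Y i \<omega>) :: real) \<in> borel_measurable M"
  by (rule measurable_compose[OF Y_measurable_unit borel_measurable_indicator])

text \<open>
  The defining property of the conditional expectation, integrated over an event of the past. All
  later probability estimates use the Markov property through this identity and its two
  consequences \<open>prob_step_ge\<close> and \<open>prob_step_le\<close>.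
\<close>

lemma prob_step:
  assumes B: "B \<in> sets (F n)" and A: "A \<in> sets unit_borel"
  shows "prob {\<omega> \<in> B. Y (Suc n) \<omega> \<in> A}
    = (LINT \<omega>|M. indicator B \<omega> * trans_prob a (Y n \<omega>) A)"
proof -
  interpret finite_measure_subalgebra M "F n"
    using subalgebra_natural_filtration[OF Y_measurable_unit]
    by unfold_locales
  have [measurable]: "B \<in> sets M" using B sets_F_subset by blast
  then have BM: "B \<subseteq> space M" by (rule sets.sets_into_space)
  note [measurable] = indicator_Y_measurable[OF A]
  have int: "integrable M (\<lambda>\<omega>. indicator A (Y (Suc n) \<omega>) :: real)"
    by (rule integrable_const_bound[where B = 1, OF _ indicator_Y_measurable[OF A]])
      (simp add: indicator_def)
  have "{\<omega> \<in> B. Y (Suc n) \<omega> \<in> A} = B \<inter> (Y (Suc n) -` A \<inter> space M)"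
    using BM by auto
  moreover have "\<dots> \<in> sets M"
    by (intro sets.Int measurable_sets[OF Y_measurable_unit A]) fact
  ultimately have "prob {\<omega> \<in> B. Y (Suc n) \<omega> \<in> A}
      = (LINT \<omega>|M. indicator {\<omega> \<in> B. Y (Suc n) \<omega> \<in> A} \<omega>)"
    by simp
  also have "\<dots> = (LINT \<omega>:B|M. indicator A (Y (Suc n) \<omega>))"
    unfolding set_lebesgue_integral_def
    by (intro Bochner_Integration.integral_cong) (auto simp: indicator_def)
  also have "\<dots> = (LINT \<omega>:B|M. real_cond_exp M (F n) (\<lambda>\<omega>. indicator A (Y (Suc n) \<omega>)) \<omega>)"
    using int B by (rule real_cond_exp_intA)
  also have "\<dots> = (LINT \<omega>|M. indicator B \<omega> * trans_prob a (Y n \<omega>) A)"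
    unfolding set_lebesgue_integral_def
  proof (rule integral_cong_AE)
    show "(\<lambda>\<omega>. indicator B \<omega> * trans_prob a (Y n \<omega>) A) \<in> borel_measurable M"
      unfolding trans_prob_eq[OF A] by measurable
    have "AE \<omega> in M. real_cond_exp M (F n) (\<lambda>\<omega>. indicator A (Y (Suc n) \<omega>)) \<omega>
        = trans_prob a (Y n \<omega>) A"
      using chain A unfolding markov_chain_def by blast
    then show "AE \<omega> in M. indicator B \<omega> *\<^sub>R real_cond_exp M (F n) (\<lambda>\<omega>. indicator A (Y (Suc n) \<omega>)) \<omega>
        = indicator B \<omega> * trans_prob a (Y n \<omega>) A"
      by eventually_elim simp
  qed measurable
  finally show ?thesis .
qed

lemma integrable_trans_prob:
  assumes "B \<in> sets M" and A: "A \<in> sets unit_borel"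
  shows "integrable M (\<lambda>\<omega>. indicator B \<omega> * trans_prob a (Y n \<omega>) A)"
proof (rule integrable_const_bound[where B = 1])
  note [measurable] = indicator_Y_measurable[OF A]
  show "(\<lambda>\<omega>. indicator B \<omega> * trans_prob a (Y n \<omega>) A) \<in> borel_measurable M"
    unfolding trans_prob_eq[OF A] using assms(1) by measurable
  show "AE \<omega> in M. norm (indicator B \<omega> * trans_prob a (Y n \<omega>) A) \<le> 1"
  proof (rule AE_I2)
    fix \<omega> assume "\<omega> \<in> space M"
    from Y_range[OF this, of n] have Y: "0 \<le> Y n \<omega>" "Y n \<omega> \<le> 1" by auto
    have "(1 - Y n \<omega>) * indicator A (Y n \<omega>) \<le> (1 - Y n \<omega>) * 1"
      "Y n \<omega> * measure (nu_law a) A \<le> Y n \<omega> * 1"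
      using Y by (intro mult_left_mono; simp add: indicator_def)+
    moreover have "0 \<le> trans_prob a (Y n \<omega>) A"
      unfolding trans_prob_eq[OF A] using Y by simp
    ultimately show "norm (indicator B \<omega> * trans_prob a (Y n \<omega>) A) \<le> 1"
      unfolding trans_prob_eq[OF A] by (auto simp: indicator_def)
  qed
qed

lemma prob_step_ge:
  assumes B: "B \<in> sets (F n)" and A: "A \<in> sets unit_borel"
    and c: "\<And>\<omega>. \<omega> \<in> B \<Longrightarrow> c \<le> trans_prob a (Y n \<omega>) A"
  shows "c * prob B \<le> prob {\<omega> \<in> B. Y (Suc n) \<omega> \<in> A}"
proof -
  have BM: "B \<in> sets M" using B sets_F_subset by blast
  have int_c: "integrable M (\<lambda>\<omega>. indicator B \<omega> * c)"
    using BM by (intro integrable_const_bound[where B = "\<bar>c\<bar>"] AE_I2) (auto simp: indicator_def)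
  have "c * prob B = (LINT \<omega>|M. indicator B \<omega> * c)" using BM by simp
  also have "\<dots> \<le> (LINT \<omega>|M. indicator B \<omega> * trans_prob a (Y n \<omega>) A)"
    using c by (intro integral_mono integrable_trans_prob[OF BM A] int_c)
      (auto simp: indicator_def)
  finally show ?thesis using prob_step[OF B A] by simp
qed

lemma prob_step_le:
  assumes B: "B \<in> sets (F n)" and A: "A \<in> sets unit_borel"
    and c: "\<And>\<omega>. \<omega> \<in> B \<Longrightarrow> trans_prob a (Y n \<omega>) A \<le> c"
  shows "prob {\<omega> \<in> B. Y (Suc n) \<omega> \<in> A} \<le> c * prob B"
proof -
  have BM: "B \<in> sets M" using B sets_F_subset by blast
  have int_c: "integrable M (\<lambda>\<omega>. indicator B \<omega> * c)"
    using BM by (intro integrable_const_bound[where B = "\<bar>c\<bar>"] AE_I2) (auto simp: indicator_def)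
  have "(LINT \<omega>|M. indicator B \<omega> * trans_prob a (Y n \<omega>) A) \<le> (LINT \<omega>|M. indicator B \<omega> * c)"
    using c by (intro integral_mono integrable_trans_prob[OF BM A] int_c)
      (auto simp: indicator_def)
  also have "\<dots> = c * prob B" using BM by simp
  finally show ?thesis using prob_step[OF B A] by simp
qed

section \<open>Stationarity\<close>

lemma distr_Y: "distr M unit_borel (Y n) = pi_law a"
proof (induction n)
  case 0
  show ?case using chain by (simp add: markov_chain_def)
next
  case (Suc n)
  interpret P: prob_space "pi_law a"
    using prob_space_distr[OF Y_measurable_unit[of n]] Suc by simp
  show ?case
  proof (rule measure_eqI)
    fix A assume "A \<in> sets (distr M unit_borel (Y (Suc n)))"
    then have A: "A \<in> sets unit_borel" by simp
    have [measurable]: "A \<in> sets (pi_law a)" using A by simp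
    have [measurable]: "(\<lambda>x. x) \<in> borel_measurable (pi_law a)"
      unfolding pi_law_def by simp
    have int_A: "integrable (pi_law a) (\<lambda>x. x * indicator A x)"
      by (intro P.integrable_const_bound[where B = 1] AE_I2) (auto simp: indicator_def)
    have int_id: "integrable (pi_law a) (\<lambda>x. x)"
      by (intro P.integrable_const_bound[where B = 1] AE_I2) auto
    have int_1: "integrable (pi_law a) (indicator A :: real \<Rightarrow> real)"
      by (intro P.integrable_const_bound[where B = 1] AE_I2) (auto simp: indicator_def)
    have int_mult: "integrable (pi_law a) (\<lambda>x. x * measure (nu_law a) A)"
      using int_id by (rule Bochner_Integration.integrable_mult_left)
    note int_diff = Bochner_Integration.integrable_diff[OF int_1 int_A]
    have [simp]: "A \<inter> {0..1} = A"
      using sets.sets_into_space[OF A] by (auto simp: space_restrict_space)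
    have mean: "(LINT x|pi_law a. x) = a / (1 + a)"
    proof -
      have "(LINT x|pi_law a. x) = (LINT x|pi_law a. x * indicator {0..1} x)"
        by (intro Bochner_Integration.integral_cong) auto
      also have "\<dots> = a / (1 + a)"
        using a_pos by (subst integral_pi_law_size_bias) (auto simp: Icc_unit_borel measure_nu_law_Icc)
      finally show ?thesis .
    qed
    have "measure (distr M unit_borel (Y (Suc n))) A = prob (Y (Suc n) -` A \<inter> space M)"
      using A Y_measurable_unit by (intro measure_distr) auto
    also have "Y (Suc n) -` A \<inter> space M = {\<omega> \<in> space M. Y (Suc n) \<omega> \<in> A}" by auto
    also have "prob \<dots> = (LINT \<omega>|M. indicator (space M) \<omega> * trans_prob a (Y n \<omega>) A)"
      using A sets.top[of "F n"] by (intro prob_step) (auto simp: space_F)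
    also have "\<dots> = (LINT \<omega>|M. trans_prob a (Y n \<omega>) A)"
      by (intro Bochner_Integration.integral_cong) auto
    also have "\<dots> = (LINT x|distr M unit_borel (Y n). trans_prob a x A)"
      using A unfolding trans_prob_eq[OF A]
      by (intro integral_distr[symmetric] Y_measurable_unit) simp
    also have "\<dots> = (LINT x|pi_law a. indicator A x - x * indicator A x + x * measure (nu_law a) A)"
      unfolding Suc trans_prob_eq[OF A] by (simp add: algebra_simps)
    also have "\<dots> = measure (pi_law a) A - (LINT x|pi_law a. x * indicator A x)
        + (LINT x|pi_law a. x) * measure (nu_law a) A"
      unfolding Bochner_Integration.integral_add[OF int_diff int_mult]
        Bochner_Integration.integral_diff[OF int_1 int_A] by simp
    also have "\<dots> = measure (pi_law a) A"
      using a_pos A by (simp add: integral_pi_law_size_bias mean)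
    finally show "emeasure (distr M unit_borel (Y (Suc n))) A = emeasure (pi_law a) A"
      using prob_space.finite_measure[OF prob_space_distr[OF Y_measurable_unit[of "Suc n"]]]
      by (simp add: P.emeasure_eq_measure finite_measure.emeasure_eq_measure)
  qed simp
qed

lemma prob_Y_gt_half: "a / (1 + a) * (1 - (1 / 2) powr (1 + a)) \<le> prob {\<omega> \<in> space M. Y n \<omega> > 1 / 2}"
proof -
  interpret P: prob_space "pi_law a"
    using prob_space_distr[OF Y_measurable_unit[of n]] distr_Y by simp
  let ?A = "{1 / 2 <.. 1 :: real}"
  have A: "?A \<in> sets unit_borel" by (rule Ioc_unit_borel) simp
  have [measurable]: "(\<lambda>x. x) \<in> borel_measurable (pi_law a)" "?A \<in> sets (pi_law a)"
    unfolding pi_law_def using A by (auto simp: sets_unit_lebesgue)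
  have [simp]: "?A \<inter> {0..1} = ?A" by auto
  have "?A = {0..1} - {0..1/2}" by auto
  then have "measure (nu_law a) ?A = 1 - (1 / 2) powr (1 + a)"
    using a_pos nu.finite_measure_Diff[of "{0..1}" "{0..1/2}"]
    by (simp add: Icc_unit_borel measure_nu_law_Icc)
  then have "a / (1 + a) * (1 - (1 / 2) powr (1 + a)) = (LINT x|pi_law a. x * indicator ?A x)"
    using a_pos A by (simp add: integral_pi_law_size_bias)
  also have "\<dots> \<le> (LINT x|pi_law a. indicator ?A x)"
    by (intro integral_mono P.integrable_const_bound[where B = 1] AE_I2) (auto simp: indicator_def)
  also have "\<dots> = measure (distr M unit_borel (Y n)) ?A"
    using A by (simp add: distr_Y)
  also have "\<dots> = prob (Y n -` ?A \<inter> space M)"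
    using A Y_measurable_unit by (intro measure_distr)
  also have "Y n -` ?A \<inter> space M = {\<omega> \<in> space M. Y n \<omega> > 1 / 2}" using Y_range by auto
  finally show ?thesis .
qed

section \<open>Excursions near zero\<close>

text \<open>
  A visit near \<open>0\<close> that starts with a jump at time \<open>j + 1\<close> and lasts at least \<open>t\<close> steps. The condition
  \<open>Y j > 1 / 2\<close> marks the start: for \<open>d \<le> 1 / 2\<close> it is incompatible with another visit in progress
  at time \<open>j\<close>.
\<close>

definition excursion :: "real \<Rightarrow> nat \<Rightarrow> nat \<Rightarrow> 'w set" where
  "excursion d t j = {\<omega> \<in> space M. Y j \<omega> > 1 / 2 \<and> (\<forall>i\<in>{j<..j + t}. Y i \<omega> \<le> d)}"

lemma excursion_sets_F:
  assumes "j + t \<le> n"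
  shows "excursion d t j \<in> sets (F n)"
proof -
  have [measurable]: "Y i \<in> borel_measurable (F n)" if "i \<in> insert j {j<..j + t}" for i
    using that assms by (intro Y_measurable_F) auto
  have "{\<omega> \<in> space (F n). Y j \<omega> > 1 / 2 \<and> (\<forall>i\<in>{j<..j + t}. Y i \<omega> \<le> d)} \<in> sets (F n)"
    by measurable
  then show ?thesis by (simp add: excursion_def space_F)
qed

lemma excursion_events [measurable]: "excursion d t j \<in> events"
  using excursion_sets_F[of j t "j + t" d] sets_F_subset by blast

lemma excursion_Suc:
  "excursion d (Suc t) j = {\<omega> \<in> excursion d t j. Y (Suc (j + t)) \<omega> \<in> {0..d}}"
proof -
  have "{j<..j + Suc t} = insert (Suc (j + t)) {j<..j + t}" by auto
  then show ?thesis using Y_range by (auto simp: excursion_def)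
qed

text \<open>
  The jump from above \<open>1 / 2\<close> into \<open>[0, d]\<close> has conditional probability at least \<open>\<nu> [0, d] / 2\<close>. Each
  of the next \<open>t\<close> steps costs at most a factor \<open>1 - d\<close>, since at a point \<open>y \<le> d\<close> the chain does not
  move with probability \<open>1 - y\<close>.
\<close>

lemma prob_excursion_ge:
  assumes "0 \<le> d" "d \<le> 1 / 2" "q \<le> prob {\<omega> \<in> space M. Y j \<omega> > 1 / 2}"
  shows "(1 - d) ^ t * (d powr (1 + a) / 2 * q) \<le> prob (excursion d (Suc t) j)"
proof (induction t)
  case 0
  have "1 / 2 * d powr (1 + a) * prob (excursion d 0 j) \<le> prob (excursion d (Suc 0) j)"
    unfolding excursion_Suc
  proof (rule order_trans[OF _ prob_step_ge])
    show "excursion d 0 j \<in> sets (F (j + 0))" by (rule excursion_sets_F) simp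
    fix \<omega> assume "\<omega> \<in> excursion d 0 j"
    then have "1 / 2 * d powr (1 + a) \<le> Y j \<omega> * d powr (1 + a)"
      by (intro mult_right_mono) (auto simp: excursion_def)
    moreover have "0 \<le> (1 - Y j \<omega>) * indicator {0..d} (Y j \<omega>)"
      using Y_range \<open>\<omega> \<in> excursion d 0 j\<close> by (auto simp: excursion_def)
    ultimately show "1 / 2 * d powr (1 + a) \<le> trans_prob a (Y (j + 0) \<omega>) {0..d}"
      using assms a_pos by (simp add: trans_prob_eq Icc_unit_borel measure_nu_law_Icc)
  qed (use assms in \<open>auto simp: Icc_unit_borel\<close>)
  moreover have "d powr (1 + a) / 2 * q \<le> d powr (1 + a) / 2 * prob (excursion d 0 j)"
    using assms(3) by (intro mult_left_mono) (auto simp: excursion_def)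
  ultimately show ?case by simp
next
  case (Suc t)
  have "(1 - d) * prob (excursion d (Suc t) j) \<le> prob (excursion d (Suc (Suc t)) j)"
    unfolding excursion_Suc[of d "Suc t"]
  proof (rule prob_step_ge)
    show "excursion d (Suc t) j \<in> sets (F (j + Suc t))" by (rule excursion_sets_F) simp
    fix \<omega> assume "\<omega> \<in> excursion d (Suc t) j"
    then have "Y (j + Suc t) \<omega> \<in> {0..d}" using Y_range by (auto simp: excursion_def)
    then show "1 - d \<le> trans_prob a (Y (j + Suc t) \<omega>) {0..d}"
      using assms a_pos by (simp add: trans_prob_eq Icc_unit_borel add_increasing2)
  qed (use assms in \<open>auto simp: Icc_unit_borel\<close>)
  moreover have "(1 - d) * ((1 - d) ^ t * (d powr (1 + a) / 2 * q))
      \<le> (1 - d) * prob (excursion d (Suc t) j)"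
    using Suc assms by (intro mult_left_mono) auto
  ultimately show ?case by (simp add: mult.assoc)
qed

text \<open>
  An excursion that starts before time \<open>m\<close> must be over by time \<open>m\<close> if another one starts there,
  because \<open>Y m > 1 / 2 \<ge> d\<close>. It is then an event of the past of \<open>m\<close>, and the new excursion needs a
  jump into \<open>[0, d]\<close>, which from above \<open>1 / 2\<close> has conditional probability at most \<open>\<nu> [0, d]\<close>.
\<close>

lemma prob_early_excursion_and_restart_le:
  assumes "0 \<le> d" "d \<le> 1 / 2" "t \<ge> 1"
  shows "prob (excursion d t m \<inter> (\<Union>i<m. excursion d t i))
    \<le> d powr (1 + a) * prob (\<Union>i<m. excursion d t i)"
proof -
  \<comment> \<open>only the excursions that are decided strictly before time \<open>m\<close>, so that \<open>V\<close> lies in \<open>F m\<close>\<close>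
  define V where "V = (\<Union>i\<in>{i. i + t < m}. excursion d t i)"
  let ?B = "{\<omega> \<in> V. Y m \<omega> > 1 / 2}"
  have fin: "finite {i. i + t < m}" by (rule finite_subset[of _ "{..<m}"]) auto
  have VF: "V \<in> sets (F m)"
    unfolding V_def using fin by (intro sets.finite_UN) (auto intro: excursion_sets_F)
  then have "V \<inter> {\<omega> \<in> space (F m). Y m \<omega> > 1 / 2} \<in> sets (F m)"
    using Y_measurable_F[of m m] by (intro sets.Int) auto
  moreover have "V \<subseteq> space M" by (auto simp: V_def excursion_def)
  ultimately have B: "?B \<in> sets (F m)"
    by (auto simp: space_F elim!: back_subst[where P = "\<lambda>A. A \<in> _"])
  have U: "(\<Union>i<m. excursion d t i) \<in> events"
    by (intro sets.finite_UN) auto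
  have "excursion d t m \<inter> (\<Union>i<m. excursion d t i) \<subseteq> {\<omega> \<in> ?B. Y (Suc m) \<omega> \<in> {0..d}}"
  proof
    fix \<omega> assume \<omega>: "\<omega> \<in> excursion d t m \<inter> (\<Union>i<m. excursion d t i)"
    then obtain i where i: "i < m" "\<omega> \<in> excursion d t i" by auto
    have Ym: "Y m \<omega> > 1 / 2" "\<omega> \<in> space M" "Y (Suc m) \<omega> \<le> d"
      using \<omega> assms(3) by (auto simp: excursion_def)
    then have "\<not> m \<le> i + t" using i assms(2) by (force simp: excursion_def)
    then show "\<omega> \<in> {\<omega> \<in> ?B. Y (Suc m) \<omega> \<in> {0..d}}"
      using i Ym Y_range by (auto simp: V_def intro!: exI[of _ i])
  qed
  moreover have "{\<omega> \<in> ?B. Y (Suc m) \<omega> \<in> {0..d}} = ?B \<inter> {\<omega> \<in> space M. Y (Suc m) \<omega> \<in> {0..d}}"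
    using \<open>V \<subseteq> space M\<close> by auto
  moreover have "\<dots> \<in> sets M" using B sets_F_subset by (intro sets.Int) auto
  ultimately have "prob (excursion d t m \<inter> (\<Union>i<m. excursion d t i))
      \<le> prob {\<omega> \<in> ?B. Y (Suc m) \<omega> \<in> {0..d}}"
    by (intro finite_measure_mono) simp_all
  also have "\<dots> \<le> d powr (1 + a) * prob ?B"
  proof (rule prob_step_le[OF B])
    fix \<omega> assume \<omega>: "\<omega> \<in> ?B"
    then have "Y m \<omega> \<le> 1" "Y m \<omega> > 1 / 2" using \<open>V \<subseteq> space M\<close> Y_range by auto
    then have "Y m \<omega> * d powr (1 + a) \<le> 1 * d powr (1 + a)" "Y m \<omega> \<notin> {0..d}"
      using assms by (auto intro: mult_right_mono mult_left_le_one_le)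
    then show "trans_prob a (Y m \<omega>) {0..d} \<le> d powr (1 + a)"
      using assms a_pos by (simp add: trans_prob_eq Icc_unit_borel measure_nu_law_Icc)
  qed (use assms in \<open>auto simp: Icc_unit_borel\<close>)
  also have "\<dots> \<le> d powr (1 + a) * prob (\<Union>i<m. excursion d t i)"
    using U by (intro mult_left_mono finite_measure_mono) (fastforce simp: V_def)+
  finally show ?thesis .
qed

text \<open>
  With \<open>s = d\<^bsup>1 + a\<^esup>\<close> and \<open>u m\<close> the probability of the union, inclusion-exclusion and the previous
  bound give \<open>u (m + 1) \<ge> u m + r s - s u m\<close>. Hence \<open>u\<close> grows by at least \<open>r s / 2\<close> per step until it
  exceeds \<open>r / 2\<close>, and \<open>r / 2\<close> is as much as is claimed while \<open>m s \<le> 1\<close>.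
\<close>

lemma prob_UN_excursion_ge:
  assumes "0 \<le> d" "d \<le> 1 / 2" "t \<ge> 1" "0 \<le> r"
    and r: "\<And>j. r * d powr (1 + a) \<le> prob (excursion d t j)"
    and "real m * d powr (1 + a) \<le> 1"
  shows "real m * (r * d powr (1 + a)) / 2 \<le> prob (\<Union>j<m. excursion d t j)"
  using assms(6)
proof (induction m)
  case (Suc m)
  let ?s = "d powr (1 + a)" and ?U = "\<Union>j<m. excursion d t j"
  have s: "?s \<ge> 0" by simp
  have m: "real m * ?s + ?s \<le> 1" using Suc.prems by (simp add: algebra_simps)
  have eq: "(\<Union>j<Suc m. excursion d t j) = ?U \<union> excursion d t m"
    by (auto simp: lessThan_Suc)
  have "prob (\<Union>j<Suc m. excursion d t j) = prob ?U + prob (excursion d t m)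
      - prob (excursion d t m \<inter> ?U)"
    unfolding eq by (subst measure_Un3) (auto simp: fmeasurable_eq_sets Int_commute)
  then have step: "prob (\<Union>j<Suc m. excursion d t j) \<ge> prob ?U + r * ?s - ?s * prob ?U"
    using prob_early_excursion_and_restart_le[OF assms(1-3), of m] r[of m] by linarith
  show ?case
  proof (cases "prob ?U \<le> r / 2")
    case True
    then have "?s * prob ?U \<le> ?s * (r / 2)" by (intro mult_left_mono) auto
    moreover have "real m * (r * ?s) / 2 \<le> prob ?U" using Suc.IH m s by linarith
    ultimately show ?thesis using step by (simp add: algebra_simps)
  next
    case False
    have "real (Suc m) * ?s * r \<le> 1 * r" using Suc.prems assms(4) by (intro mult_right_mono)
    moreover have "prob ?U \<le> prob (\<Union>j<Suc m. excursion d t j)"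
      unfolding eq by (intro finite_measure_mono) auto
    ultimately show ?thesis using False by (simp add: algebra_simps)
  qed
qed simp

section \<open>Partial sums along an excursion\<close>

lemma powr_Y_mean_ge:
  assumes "\<gamma> > 0" "q \<le> prob {\<omega> \<in> space M. Y i \<omega> > 1 / 2}"
  shows "(1 / 2) powr \<gamma> * q \<le> (LINT \<omega>|M. Y i \<omega> powr \<gamma>)"
proof -
  let ?A = "{\<omega> \<in> space M. Y i \<omega> > 1 / 2}"
  have "(1 / 2) powr \<gamma> * q \<le> (1 / 2) powr \<gamma> * prob ?A" using assms(2) by (intro mult_left_mono) auto
  also have "\<dots> = (LINT \<omega>|M. (1 / 2) powr \<gamma> * indicator ?A \<omega>)" by simp
  also have "\<dots> \<le> (LINT \<omega>|M. Y i \<omega> powr \<gamma>)"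
  proof (rule integral_mono)
    show "integrable M (\<lambda>\<omega>. Y i \<omega> powr \<gamma>)"
      using Y_range assms(1) by (intro integrable_const_bound[where B = 1] AE_I2) (auto simp: powr_le1)
    show "(1 / 2) powr \<gamma> * indicator ?A \<omega> \<le> Y i \<omega> powr \<gamma>" for \<omega>
      using assms(1) by (auto simp: indicator_def intro!: powr_mono2)
  qed (auto simp: less_top[symmetric])
  finally show ?thesis .
qed

text \<open>
  The partial sums decrease by at least \<open>t \<mu> / 2 \<ge> 2 x\<close> between the times \<open>j + 1\<close> and \<open>j + t + 1\<close>, so
  they cannot both lie in \<open>(- x, x)\<close>.
\<close>

lemma max_partial_sum_ge_on_excursion:
  assumes "\<omega> \<in> excursion d t j" "j + t < n"
    and \<mu>: "\<And>i. \<mu> \<le> (LINT \<omega>|M. Y i \<omega> powr \<gamma>)"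
    and "\<gamma> > 0" "d powr \<gamma> \<le> \<mu> / 2" "2 * x \<le> real t * (\<mu> / 2)"
  shows "x \<le> (MAX k\<in>{1..n}. \<bar>\<Sum>i=0..<k. (Y i \<omega> powr \<gamma> - (LINT \<omega>'|M. Y i \<omega>' powr \<gamma>))\<bar>)"
proof -
  define f where "f i = Y i \<omega> powr \<gamma> - (LINT \<omega>'|M. Y i \<omega>' powr \<gamma>)" for i
  define S where "S k = sum f {0..<k}" for k
  have f: "f i \<le> - (\<mu> / 2)" if "i \<in> {Suc j..<Suc (j + t)}" for i
  proof -
    have "0 \<le> Y i \<omega>" "Y i \<omega> \<le> d" using assms(1) that Y_range by (auto simp: excursion_def)
    then have "Y i \<omega> powr \<gamma> \<le> d powr \<gamma>" using assms(4) by (intro powr_mono2) auto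
    then show ?thesis using \<mu>[of i] assms(5) by (simp add: f_def)
  qed
  have "S (Suc (j + t)) - S (Suc j) = sum f {Suc j..<Suc (j + t)}"
    unfolding S_def by (rule sum_diff_nat_ivl) auto
  also have "\<dots> \<le> of_nat (card {Suc j..<Suc (j + t)}) * (- (\<mu> / 2))"
    using f by (rule sum_bounded_above)
  also have "\<dots> \<le> - 2 * x" using assms(6) by simp
  finally have "x \<le> \<bar>S (Suc (j + t))\<bar> \<or> x \<le> \<bar>S (Suc j)\<bar>" by linarith
  moreover have "Suc (j + t) \<in> {1..n}" "Suc j \<in> {1..n}" using assms(2) by auto
  ultimately have "\<exists>k\<in>{1..n}. x \<le> \<bar>S k\<bar>" by blast
  then have "x \<le> (MAX k\<in>{1..n}. \<bar>S k\<bar>)" by (subst Max_ge_iff) auto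
  then show ?thesis by (simp add: S_def f_def)
qed

lemma max_partial_sum_tail:
  assumes "\<gamma> > 0"
  obtains \<mu> C :: real where "\<mu> > 0" "C > 0"
    "\<And>n x. \<lbrakk>real n powr (1 / (1 + a)) \<le> x; 1 \<le> n; x \<le> \<mu> / 10 * real n\<rbrakk> \<Longrightarrow>
      C * (real n / x powr (1 + a)) \<le> prob {\<omega> \<in> space M.
        x \<le> (MAX k\<in>{1..n}. \<bar>\<Sum>i=0..<k. (Y i \<omega> powr \<gamma> - (LINT \<omega>'|M. Y i \<omega>' powr \<gamma>))\<bar>)}"
proof -
  define q where "q = a / (1 + a) * (1 - (1 / 2) powr (1 + a))"
  define \<mu> where "\<mu> = (1 / 2) powr \<gamma> * q"
  \<comment> \<open>chosen so that every term of an excursion below \<open>\<epsilon>\<close> is at most half of its mean\<close>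
  define \<epsilon> where "\<epsilon> = min (1 / 2) ((\<mu> / 2) powr (1 / \<gamma>))"
  define C where "C = q / 16 * (\<epsilon> * \<mu> / 5) powr (1 + a)"
  have q: "q \<le> prob {\<omega> \<in> space M. Y i \<omega> > 1 / 2}" for i
    unfolding q_def by (rule prob_Y_gt_half)
  have "(1 / 2 :: real) powr (1 + a) < (1 / 2) powr 0"
    using a_pos by (intro powr_less_mono') auto
  then have q0: "q > 0" using a_pos by (simp add: q_def)
  have q1: "q \<le> 1" using q[of 0] prob_le_1 order_trans by blast
  have \<mu>0: "\<mu> > 0" using q0 by (simp add: \<mu>_def)
  have "(1 / 2 :: real) powr \<gamma> \<le> 1" using assms by (intro powr_le1) auto
  then have \<mu>1: "\<mu> \<le> 1" unfolding \<mu>_def using q0 q1 by (intro mult_le_one) auto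
  have \<epsilon>: "\<epsilon> > 0" "\<epsilon> \<le> 1 / 2" using \<mu>0 by (auto simp: \<epsilon>_def)
  have "\<epsilon> powr \<gamma> \<le> ((\<mu> / 2) powr (1 / \<gamma>)) powr \<gamma>"
    using \<epsilon> assms by (intro powr_mono2) (auto simp: \<epsilon>_def)
  then have \<epsilon>\<gamma>: "\<epsilon> powr \<gamma> \<le> \<mu> / 2" using assms \<mu>0 by (simp add: powr_powr)
  have C0: "C > 0" using q0 \<epsilon> \<mu>0 by (simp add: C_def)
  have "C * (real n / x powr (1 + a)) \<le> prob {\<omega> \<in> space M.
      x \<le> (MAX k\<in>{1..n}. \<bar>\<Sum>i=0..<k. (Y i \<omega> powr \<gamma> - (LINT \<omega>'|M. Y i \<omega>' powr \<gamma>))\<bar>)}"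
    (is "_ \<le> prob ?G")
    if x: "real n powr (1 / (1 + a)) \<le> x" "x \<le> \<mu> / 10 * real n" and n: "1 \<le> n" for n x
  proof -
    have x1: "x \<ge> 1" using x(1) n a_pos ge_one_powr_ge_zero[of "real n" "1 / (1 + a)"] by simp
    \<comment> \<open>the shortest length for which the drop \<open>t \<mu> / 2\<close> reaches \<open>2 x\<close>; leaving \<open>[0, d]\<close> within it
      has probability at most \<open>t d = \<epsilon>\<close>\<close>
    define t where "t = nat \<lceil>4 * x / \<mu>\<rceil>"
    define d where "d = \<epsilon> / real t"
    have t_lower: "4 * x / \<mu> \<le> real t" unfolding t_def by linarith
    have "x \<le> x / \<mu>" using x1 \<mu>0 \<mu>1 by (simp add: le_divide_eq mult_left_le)
    then have t: "1 \<le> t" "x \<le> real t" "real t \<le> 5 * x / \<mu>"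
      using x1 t_lower unfolding t_def by linarith+
    have "5 * x / \<mu> \<le> real n / 2" using x(2) \<mu>0 by (simp add: field_simps)
    with t(3) have tn: "real t \<le> real n / 2" by linarith
    have d: "0 < d" "d \<le> \<epsilon>" using \<epsilon> t by (auto simp: d_def divide_le_eq mult_le_cancel_left1)
    then have d2: "d \<le> 1 / 2" using \<epsilon> by simp
    have "real n = (real n powr (1 / (1 + a))) powr (1 + a)"
      using a_pos n by (simp add: powr_powr)
    also have "\<dots> \<le> real t powr (1 + a)" using x(1) t(2) a_pos by (intro powr_mono2) auto
    finally have nt: "real n \<le> real t powr (1 + a)" .
    have ds: "d powr (1 + a) = \<epsilon> powr (1 + a) / real t powr (1 + a)"
      using \<epsilon> by (simp add: d_def powr_divide)
    have "\<epsilon> powr (1 + a) \<le> 1" using \<epsilon> a_pos by (intro powr_le1) auto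
    then have "real n * \<epsilon> powr (1 + a) \<le> real t powr (1 + a) * 1"
      using nt by (intro mult_mono) auto
    then have nd: "real n * d powr (1 + a) \<le> 1" using t by (simp add: ds)
    have "real (n - t) * d powr (1 + a) \<le> real n * d powr (1 + a)"
      by (intro mult_right_mono) auto
    with nd have md: "real (n - t) * d powr (1 + a) \<le> 1" by linarith
    have exc: "q / 4 * d powr (1 + a) \<le> prob (excursion d t j)" for j
    proof -
      have "1 / 2 \<le> 1 - \<epsilon>" using \<epsilon> by simp
      also have "\<dots> \<le> 1 + real (t - 1) * (- d)"
        using \<epsilon> t by (simp add: d_def of_nat_diff field_simps)
      also have "\<dots> \<le> (1 + (- d)) ^ (t - 1)"
        using d2 by (intro Bernoulli_inequality) auto
      finally have "1 / 2 * (d powr (1 + a) / 2 * q) \<le> (1 - d) ^ (t - 1) * (d powr (1 + a) / 2 * q)"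
        using q0 by (intro mult_right_mono) auto
      also have "\<dots> \<le> prob (excursion d (Suc (t - 1)) j)"
        using d d2 q by (intro prob_excursion_ge) auto
      finally show ?thesis using t by (simp add: mult_ac)
    qed
    have "C * (real n / x powr (1 + a))
        = real n / 2 * (q / 4 * ((\<epsilon> * \<mu> / 5) powr (1 + a) / x powr (1 + a))) / 2"
      by (simp add: C_def)
    also have "(\<epsilon> * \<mu> / 5) powr (1 + a) / x powr (1 + a) = (\<epsilon> * \<mu> / 5 / x) powr (1 + a)"
      using \<epsilon> \<mu>0 x1 by (subst powr_divide) auto
    also have "\<epsilon> * \<mu> / 5 / x = \<epsilon> / (5 * x / \<mu>)" by simp
    also have "real n / 2 * (q / 4 * (\<epsilon> / (5 * x / \<mu>)) powr (1 + a)) / 2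
        \<le> real (n - t) * (q / 4 * d powr (1 + a)) / 2"
      unfolding d_def using tn q0 \<epsilon> t x1 \<mu>0 a_pos
      by (intro divide_right_mono mult_mono powr_mono2 divide_left_mono)
        (auto simp: of_nat_diff)
    also have "\<dots> \<le> prob (\<Union>j<n - t. excursion d t j)"
      using d d2 t exc md q0 by (intro prob_UN_excursion_ge) auto
    also have "\<dots> \<le> prob ?G"
    proof (rule finite_measure_mono)
      show "(\<Union>j<n - t. excursion d t j) \<subseteq> ?G"
      proof
        fix \<omega> assume "\<omega> \<in> (\<Union>j<n - t. excursion d t j)"
        then obtain j where "j < n - t" and "\<omega> \<in> excursion d t j" by blast
        then have j: "j + t < n" "\<omega> \<in> excursion d t j" by auto
        have "d powr \<gamma> \<le> \<epsilon> powr \<gamma>" using d assms by (intro powr_mono2) auto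
        moreover have "2 * x \<le> real t * (\<mu> / 2)" using t_lower \<mu>0 by (simp add: field_simps)
        ultimately show "\<omega> \<in> ?G"
          using max_partial_sum_ge_on_excursion[OF j(2,1), of \<mu> \<gamma> x] \<epsilon>\<gamma> assms
            powr_Y_mean_ge[OF assms q] j(2)
          by (auto simp: \<mu>_def excursion_def)
      qed
      show "?G \<in> sets M" using n by measurable
    qed
    finally show ?thesis .
  qed
  with \<mu>0 C0 show ?thesis using that by blast
qed

end

theorem proposition4p4:
  fixes p \<gamma> a :: real
    and M :: "'w measure"
    and Y :: "nat \<Rightarrow> 'w \<Rightarrow> real"
  assumes "p > 1" and "\<gamma> > 0" and "a = p - 1"
    and "markov_chain M unit_borel (pi_law a) (trans_prob a) Y"
  shows "\<exists>\<kappa>::real. \<kappa> > 0 \<and>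
    (\<forall>n::nat. \<forall>x::real. n \<ge> 1 \<longrightarrow> x \<in> {\<kappa> * real n powr (1 / p) .. inverse \<kappa> * real n} \<longrightarrow>
      measure M {\<omega> \<in> space M.
          (MAX k\<in>{1..n}. \<bar>\<Sum>i=0..<k. (Y i \<omega> powr \<gamma> - (LINT \<omega>'|M. Y i \<omega>' powr \<gamma>))\<bar>) \<ge> x}
        \<ge> inverse \<kappa> * (real n / x powr p))"
proof -
  interpret lazy_chain a M Y
    using assms by unfold_locales auto
  have p: "1 + a = p" using assms(3) by simp
  obtain \<mu> C where C: "\<mu> > 0" "C > 0"
    "\<And>n x. \<lbrakk>real n powr (1 / p) \<le> x; 1 \<le> n; x \<le> \<mu> / 10 * real n\<rbrakk> \<Longrightarrow>
      C * (real n / x powr p) \<le> prob {\<omega> \<in> space M.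
        x \<le> (MAX k\<in>{1..n}. \<bar>\<Sum>i=0..<k. (Y i \<omega> powr \<gamma> - (LINT \<omega>'|M. Y i \<omega>' powr \<gamma>))\<bar>)}"
    using max_partial_sum_tail[OF assms(2)] unfolding p by blast
  define \<kappa> where "\<kappa> = 1 + 10 / \<mu> + 1 / C"
  have \<kappa>: "\<kappa> \<ge> 1" "10 / \<mu> \<le> \<kappa>" "1 / C \<le> \<kappa>" using C by (auto simp: \<kappa>_def)
  have inv: "inverse \<kappa> \<le> \<mu> / 10" "inverse \<kappa> \<le> C"
    using le_imp_inverse_le[OF \<kappa>(2)] le_imp_inverse_le[OF \<kappa>(3)] C by auto
  show ?thesis
  proof (intro exI[of _ \<kappa>] conjI allI impI)
    show "\<kappa> > 0" using \<kappa> by simp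
    fix n :: nat and x :: real
    assume n: "n \<ge> 1" and x: "x \<in> {\<kappa> * real n powr (1 / p) .. inverse \<kappa> * real n}"
    have "1 * real n powr (1 / p) \<le> \<kappa> * real n powr (1 / p)" using \<kappa> by (intro mult_right_mono) auto
    then have "real n powr (1 / p) \<le> x" using x by auto
    moreover have "inverse \<kappa> * real n \<le> \<mu> / 10 * real n" using inv by (intro mult_right_mono) auto
    then have "x \<le> \<mu> / 10 * real n" using x by auto
    moreover have "inverse \<kappa> * (real n / x powr p) \<le> C * (real n / x powr p)"
      using inv by (intro mult_right_mono) auto
    ultimately show "measure M {\<omega> \<in> space M.
          (MAX k\<in>{1..n}. \<bar>\<Sum>i=0..<k. (Y i \<omega> powr \<gamma> - (LINT \<omega>'|M. Y i \<omega>' powr \<gamma>))\<bar>) \<ge> x}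
        \<ge> inverse \<kappa> * (real n / x powr p)"
      using C(3)[of n x] n by linarith
  qed
qed

end
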